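(* (Alternation Theorem, smaller vs. larger.) For every integer $\ell \ge 1$ there is a first-order $\tau_{\mathsf{ord}}$-sentence $\sigma_\ell$ in prenex form separating $L_{\le \ell}$ from $L_{>\ell}$ that has exactly $q^*(\ell)$ quantifiers (and so at most $\log(\ell)+2$ quantifiers), and whose quantifier prefix strictly alternates between $\exists$ and $\forall$ and ends with $\forall$.
   Context: Let $\tau_{\mathsf{ord}} = \langle <; \mathsf{min}, \mathsf{max}\rangle$ with $<$ binary and $\mathsf{min},\mathsf{max}$ constants. For $\ell \ge 1$, $L_\ell$ denotes the linear order on $\ell+1$ elements with $\mathsf{min},\mathsf{max}$ interpreted as its first and last elements ($\ell$ is its length); $L_{\le\ell}=\{L_1,\dots,L_\ell\}$, $L_{>\ell}=\{L_m: m>\ell\}$. A sentence separates $\mathcal{A}$ from $\mathcal{B}$ if it is true in all structures of $\mathcal{A}$ and false in all structures of $\mathcal{B}$. $\log$ is base 2. The functions $q^*_\forall, q^*_\exists:\mathbb{N}_{\ge1}\to\mathbb{N}$ (the number of rounds used by the paper's "closest-to-midpoint with alternation" Spoiler strategy starting with a universal, resp. existential, move) satisfy and are determined by: $q^*_\forall(1)=1$, $q^*_\exists(1)=2$, $q^*_\forall(2)=2$; $q^*_\exists(2m)=q^*_\forall(m)+1$ and $q^*_\exists(2m+1)=q^*_\forall(m+1)+1$ for $m\ge1$; $q^*_\forall(2m)=q^*_\exists(m)+1$ for $m\ge2$; $q^*_\forall(2m+1)=q^*_\exists(m)+1$ for $m\ge1$. Finally $q^*(\ell)=\min(q^*_\forall(\ell),q^*_\exists(\ell))$.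 *)

theory Defs
  imports Complex_Main
begin

datatype tm = Var nat | Min_const | Max_const

datatype fm =
    Eq tm tm
  | Less tm tm
  | Neg fm
  | Conj fm fm
  | Disj fm fm
  | Exists nat fm
  | Forall nat fm

record 'a ord_struct =
  universe :: "'a set"
  less_in :: "'a \<Rightarrow> 'a \<Rightarrow> bool"
  min_in :: 'a
  max_in :: 'a

fun tm_val :: "('a, 'm) ord_struct_scheme \<Rightarrow> (nat \<Rightarrow> 'a) \<Rightarrow> tm \<Rightarrow> 'a" where
  "tm_val M e (Var x) = e x"
| "tm_val M e Min_const = min_in M"
| "tm_val M e Max_const = max_in M"

fun sat :: "('a, 'm) ord_struct_scheme \<Rightarrow> (nat \<Rightarrow> 'a) \<Rightarrow> fm \<Rightarrow> bool" where
  "sat M e (Eq s t) = (tm_val M e s = tm_val M e t)"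
| "sat M e (Less s t) = less_in M (tm_val M e s) (tm_val M e t)"
| "sat M e (Neg \<phi>) = (\<not> sat M e \<phi>)"
| "sat M e (Conj \<phi> \<psi>) = (sat M e \<phi> \<and> sat M e \<psi>)"
| "sat M e (Disj \<phi> \<psi>) = (sat M e \<phi> \<or> sat M e \<psi>)"
| "sat M e (Exists x \<phi>) = (\<exists>a\<in>universe M. sat M (e(x := a)) \<phi>)"
| "sat M e (Forall x \<phi>) = (\<forall>a\<in>universe M. sat M (e(x := a)) \<phi>)"

fun tm_vars :: "tm \<Rightarrow> nat set" where
  "tm_vars (Var x) = {x}"
| "tm_vars Min_const = {}"
| "tm_vars Max_const = {}"

fun free_vars :: "fm \<Rightarrow> nat set" where
  "free_vars (Eq s t) = tm_vars s \<union> tm_vars t"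
| "free_vars (Less s t) = tm_vars s \<union> tm_vars t"
| "free_vars (Neg \<phi>) = free_vars \<phi>"
| "free_vars (Conj \<phi> \<psi>) = free_vars \<phi> \<union> free_vars \<psi>"
| "free_vars (Disj \<phi> \<psi>) = free_vars \<phi> \<union> free_vars \<psi>"
| "free_vars (Exists x \<phi>) = free_vars \<phi> - {x}"
| "free_vars (Forall x \<phi>) = free_vars \<phi> - {x}"

definition sentence :: "fm \<Rightarrow> bool" where
  "sentence \<phi> \<longleftrightarrow> free_vars \<phi> = {}"

text \<open>For a sentence and a structure with nonempty universe the assignment is immaterial, so
  failure of \<open>true_in\<close> means that the sentence is false in the structure.\<close>

definition true_in :: "('a, 'm) ord_struct_scheme \<Rightarrow> fm \<Rightarrow> bool" where
  "true_in M \<phi> \<longleftrightarrow> (\<forall>e. range e \<subseteq> universe M \<longrightarrow> sat M e \<phi>)"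

definition separates :: "fm \<Rightarrow> 'a ord_struct set \<Rightarrow> 'a ord_struct set \<Rightarrow> bool" where
  "separates \<phi> \<A> \<B> \<longleftrightarrow> (\<forall>M\<in>\<A>. true_in M \<phi>) \<and> (\<forall>M\<in>\<B>. \<not> true_in M \<phi>)"

text \<open>Occurrences of quantifiers are counted, not quantifier rank.\<close>

fun num_quants :: "fm \<Rightarrow> nat" where
  "num_quants (Eq s t) = 0"
| "num_quants (Less s t) = 0"
| "num_quants (Neg \<phi>) = num_quants \<phi>"
| "num_quants (Conj \<phi> \<psi>) = num_quants \<phi> + num_quants \<psi>"
| "num_quants (Disj \<phi> \<psi>) = num_quants \<phi> + num_quants \<psi>"
| "num_quants (Exists x \<phi>) = Suc (num_quants \<phi>)"
| "num_quants (Forall x \<phi>) = Suc (num_quants \<phi>)"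

fun prenex :: "fm \<Rightarrow> bool" where
  "prenex (Exists x \<phi>) = prenex \<phi>"
| "prenex (Forall x \<phi>) = prenex \<phi>"
| "prenex \<phi> = (num_quants \<phi> = 0)"

datatype quant = QExists | QForall

fun quant_prefix :: "fm \<Rightarrow> quant list" where
  "quant_prefix (Exists x \<phi>) = QExists # quant_prefix \<phi>"
| "quant_prefix (Forall x \<phi>) = QForall # quant_prefix \<phi>"
| "quant_prefix \<phi> = []"

text \<open>The index is the length: \<open>lin_ord l\<close> has \<open>l + 1\<close> elements.\<close>

definition lin_ord :: "nat \<Rightarrow> nat ord_struct" where
  "lin_ord l = \<lparr>universe = {0..l}, less_in = (<), min_in = 0, max_in = l\<rparr>"

definition lin_ords_le :: "nat \<Rightarrow> nat ord_struct set" where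
  "lin_ords_le l = lin_ord ` {1..l}"

definition lin_ords_gt :: "nat \<Rightarrow> nat ord_struct set" where
  "lin_ords_gt l = lin_ord ` {l<..}"

text \<open>Numbers of rounds used by Spoiler's closest-to-midpoint strategy with alternation, starting with
  a universal, resp. existential, move. Only arguments \<open>l \<ge> 1\<close> are meaningful; the value at \<open>0\<close> is arbitrary. The defining
  recurrences by parity are recovered below.\<close>

function q_forall :: "nat \<Rightarrow> nat" and q_exists :: "nat \<Rightarrow> nat" where
  "q_forall l = (if l \<le> 1 then 1 else if l = 2 then 2 else q_exists (l div 2) + 1)"
| "q_exists l = (if l \<le> 1 then 2 else q_forall ((l + 1) div 2) + 1)"
  by pat_completeness auto
termination
  by (relation "measure (case_sum id id)") auto

declare q_forall.simps [simp del] q_exists.simps [simp del]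

definition q_star :: "nat \<Rightarrow> nat" where
  "q_star l = min (q_forall l) (q_exists l)"

lemma q_recurrences:
  "q_forall 1 = 1"
  "q_exists 1 = 2"
  "q_forall 2 = 2"
  "m \<ge> 1 \<Longrightarrow> q_exists (2 * m) = q_forall m + 1"
  "m \<ge> 1 \<Longrightarrow> q_exists (2 * m + 1) = q_forall (m + 1) + 1"
  "m \<ge> 2 \<Longrightarrow> q_forall (2 * m) = q_exists m + 1"
  "m \<ge> 1 \<Longrightarrow> q_forall (2 * m + 1) = q_exists m + 1"
  by (subst q_forall.simps q_exists.simps; simp)+

end

theory Submission
  imports Defs
begin

text \<open>Write \<open>|a b|\<close> for the length of the interval from \<open>a\<close> to \<open>b\<close>. Then \<open>|a b| \<le> 2k + 1\<close> says that
  every \<open>x\<close> strictly between \<open>a\<close> and \<open>b\<close> has \<open>|a x| \<le> k\<close> or \<open>|x b| \<le> k\<close>, and \<open>|a b| \<le> 2k\<close> says that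
  some \<open>x\<close> has \<open>|a x| \<le> k\<close> and \<open>|x b| \<le> k\<close>. Alternating the two steps keeps the sentence prenex
  without doubling the quantifiers: after a universal step the two halves form a disjunction whose
  next quantifier is existential, so a single witness can be shared and its position tells
  which half is meant; dually after an existential step. Every step doubles the threshold (up to
  rounding), and an alternating prefix ending in \<open>\<forall>\<close> turns out to be optimal for the recurrences of
  \<open>q_star\<close>.\<close>

section \<open>Arithmetic of the thresholds\<close>

text \<open>For \<open>n > 0\<close> this is the largest \<open>l\<close> with
  \<open>q_star l \<le> n\<close>; the values are 0, 1, 2, 5, 10, 21, that is,
  \<open>2 ^ (n + 1) div 3\<close>. The extra unit belongs to a universal outermost step.\<close>

fun reach :: "nat \<Rightarrow> nat" where
  "reach 0 = 0"
| "reach (Suc n) = 2 * reach n + (if even n then 1 else 0)"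

lemma two_power_le_reach: "2 ^ n \<le> reach (Suc n)"
proof (induction n)
  case (Suc n)
  then show ?case
    by (subst reach.simps(2)) (simp del: reach.simps)
qed simp

lemma reach_pos: "1 \<le> reach (Suc n)"
  using two_power_le_reach[of n] one_le_power[of "2::nat" n] by linarith

text \<open>A prefix of length \<open>n\<close> that alternates and ends in \<forall> starts with
  \<exists> exactly for even \<open>n\<close>; this fixes which of the two recurrences halves
  \<open>l\<close> in step with \<open>reach\<close>.\<close>

lemma q_le_if_le_reach:
  "1 \<le> l \<Longrightarrow> l \<le> reach n \<Longrightarrow> (if even n then q_exists l else q_forall l) \<le> n"
proof (induction n arbitrary: l)
  case 0
  then show ?case by simp
next
  case (Suc n)
  show ?case
  proof (cases "even n")
    case True
    \<comment> \<open>\<open>q_forall\<close> has a separate base value at 2; since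
      \<open>reach 1 = 1\<close>, that length occurs only for \<open>n \<noteq> 0\<close>.\<close>
    consider "l = 1" | "l = 2" "n \<noteq> 0" | "l > 2"
      using Suc.prems by (cases "n = 0") fastforce+
    then show ?thesis
    proof cases
      case 3
      then have "q_exists (l div 2) \<le> n"
        using Suc.IH[of "l div 2"] Suc.prems True by auto
      then show ?thesis
        using 3 True by (simp add: q_forall.simps[of l])
    qed (use True in \<open>simp_all add: q_forall.simps\<close>)
  next
    case False
    show ?thesis
    proof (cases "l = 1")
      case True
      then show ?thesis
        using False by (auto simp: q_exists.simps elim: oddE)
    next
      case l: False
      then have "q_forall ((l + 1) div 2) \<le> n"
        using Suc.IH[of "(l + 1) div 2"] Suc.prems False by auto
      then show ?thesis
        using l False Suc.prems by (simp add: q_exists.simps[of l])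
    qed
  qed
qed

text \<open>The extra unit for odd \<open>n\<close> absorbs the rounding loss of a strategy whose parity disagrees with
  a prefix ending in \<open>\<forall>\<close>.\<close>

lemma le_reach_if_q_le:
  "(q_forall l \<le> n \<longrightarrow> l \<le> reach n) \<and>
   (q_exists l \<le> n \<longrightarrow> l + (if odd n then 1 else 0) \<le> reach n)"
proof (induction n arbitrary: l)
  case 0
  show ?case
    by (simp add: q_forall.simps[of l] q_exists.simps[of l])
next
  case (Suc n)
  have "l \<le> reach (Suc n)" if "q_forall l \<le> Suc n"
  proof -
    consider "l \<le> 1" | "l = 2" | "l > 2" by linarith
    then show ?thesis
    proof cases
      case 1
      then show ?thesis using reach_pos[of n] by linarith
    next
      case 2
      then obtain k where "n = Suc k"
        using \<open>q_forall l \<le> Suc n\<close> by (cases n) (auto simp: q_forall.simps)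
      then show ?thesis
        using reach_pos[of k] 2 by simp
    next
      case 3
      then have "q_exists (l div 2) \<le> n"
        using \<open>q_forall l \<le> Suc n\<close> by (simp add: q_forall.simps[of l])
      \<comment> \<open>The remainder lost in \<open>l div 2\<close> is covered for odd
        \<open>n\<close> by the doubled extra unit, and for even \<open>n\<close> by the unit in
        \<open>reach (Suc n)\<close>.\<close>
      then have "l div 2 + (if odd n then 1 else 0) \<le> reach n"
        using Suc.IH by blast
      then show ?thesis by (auto split: if_splits)
    qed
  qed
  moreover have "l + (if odd (Suc n) then 1 else 0) \<le> reach (Suc n)" if "q_exists l \<le> Suc n"
  proof (cases "l \<le> 1")
    case True
    then obtain k where "n = Suc k"
      using \<open>q_exists l \<le> Suc n\<close> by (cases n) (auto simp: q_exists.simps)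
    then show ?thesis
      using reach_pos[of k] True by simp
  next
    case False
    then have "q_forall ((l + 1) div 2) \<le> n"
      using that by (simp add: q_exists.simps[of l])
    then have "(l + 1) div 2 \<le> reach n"
      using Suc.IH by blast
    then show ?thesis by auto
  qed
  ultimately show ?case by blast
qed

text \<open>Either starting quantifier yields \<open>l \<le> reach n\<close>, while the converse
  already holds for the one that lets a prefix of length \<open>n\<close> end in \<forall>. So
  insisting on this ending costs no quantifier.\<close>

lemma q_star_le_iff: "1 \<le> l \<Longrightarrow> q_star l \<le> n \<longleftrightarrow> l \<le> reach n"
  using q_le_if_le_reach[of l n] le_reach_if_q_le[of l n]
  by (auto simp: q_star_def min_le_iff_disj split: if_splits)

section \<open>Alternating quantifier prefixes\<close>

text \<open>The parity is that of the number of quantifiers still to come, which makes the innermost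
  one \<forall> whatever the length.\<close>

fun alt_prefix :: "nat \<Rightarrow> nat \<Rightarrow> fm \<Rightarrow> fm" where
  "alt_prefix 0 v \<phi> = \<phi>"
| "alt_prefix (Suc n) v \<phi> =
    (if even n then Forall v (alt_prefix n (Suc v) \<phi>) else Exists v (alt_prefix n (Suc v) \<phi>))"

lemma num_quants_alt_prefix: "num_quants (alt_prefix n v \<phi>) = n + num_quants \<phi>"
  by (induction n arbitrary: v) auto

lemma free_vars_alt_prefix: "free_vars (alt_prefix n v \<phi>) = free_vars \<phi> - {v..<v + n}"
  by (induction n arbitrary: v) (auto simp: not_less_eq_eq)

lemma prenex_if_quantifier_free: "num_quants \<phi> = 0 \<Longrightarrow> prenex \<phi>"
  by (cases \<phi>) auto

lemma prenex_alt_prefix: "num_quants \<phi> = 0 \<Longrightarrow> prenex (alt_prefix n v \<phi>)"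
  by (induction n arbitrary: v) (auto simp: prenex_if_quantifier_free)

lemma quant_prefix_eq_Nil_if_quantifier_free: "num_quants \<phi> = 0 \<Longrightarrow> quant_prefix \<phi> = []"
  by (cases \<phi>) auto

text \<open>The first quantifier is recorded because the induction for \<open>distinct_adj\<close>
  compares it with the newly added one.\<close>

lemma quant_prefix_alt_prefix:
  assumes "num_quants \<phi> = 0"
  shows "quant_prefix (alt_prefix (Suc n) v \<phi>) \<noteq> []
    \<and> hd (quant_prefix (alt_prefix (Suc n) v \<phi>)) = (if even n then QForall else QExists)
    \<and> last (quant_prefix (alt_prefix (Suc n) v \<phi>)) = QForall
    \<and> distinct_adj (quant_prefix (alt_prefix (Suc n) v \<phi>))"
proof (induction n arbitrary: v)
  case 0
  then show ?case
    using assms by (simp add: quant_prefix_eq_Nil_if_quantifier_free)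
next
  case (Suc n)
  from Suc[of "Suc v"] show ?case
    by (subst (1 2 3 4) alt_prefix.simps(2)) (auto simp: distinct_adj_Cons simp del: alt_prefix.simps)
qed

text \<open>The prefix rebinds only variables from \<open>v\<close> on. Once the earlier witnesses
  are fixed, the matrix can thus be simplified underneath it.\<close>

lemma sat_alt_prefix_cong:
  assumes "\<And>e'. (\<And>i. i < v \<Longrightarrow> e' i = e i) \<Longrightarrow> sat M e' \<phi> \<longleftrightarrow> sat M e' \<psi>"
  shows "sat M e (alt_prefix n v \<phi>) \<longleftrightarrow> sat M e (alt_prefix n v \<psi>)"
  using assms
proof (induction n arbitrary: v e)
  case (Suc n)
  have "sat M (e(v := y)) (alt_prefix n (Suc v) \<phi>) \<longleftrightarrow> sat M (e(v := y)) (alt_prefix n (Suc v) \<psi>)"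
    for y
    by (rule Suc.IH) (rule Suc.prems, simp)
  then show ?case by simp
qed simp

lemma sat_alt_prefix_const:
  assumes "universe M \<noteq> {}" "\<And>e'. (\<And>i. i < v \<Longrightarrow> e' i = e i) \<Longrightarrow> sat M e' \<phi> \<longleftrightarrow> c"
  shows "sat M e (alt_prefix n v \<phi>) \<longleftrightarrow> c"
  using assms(2)
proof (induction n arbitrary: v e)
  case (Suc n)
  have "sat M (e(v := y)) (alt_prefix n (Suc v) \<phi>) \<longleftrightarrow> c" for y
    by (rule Suc.IH) (rule Suc.prems, simp)
  then show ?case using assms(1) by auto
qed simp

section \<open>The quantifier-free matrix\<close>

text \<open>For even \<open>n\<close> the interval from \<open>a\<close> to \<open>b\<close> is assumed to be nondegenerate; this is why \<open>n = 0\<close>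
  gives an unsatisfiable formula. The witness ranges over the interval open at \<open>a\<close> and closed at
  \<open>b\<close>, so that witnesses for adjacent intervals are never confused.\<close>

fun bound_matrix :: "nat \<Rightarrow> nat \<Rightarrow> tm \<Rightarrow> tm \<Rightarrow> nat \<Rightarrow> fm" where
  "bound_matrix 0 l a b v = Less a a"
| "bound_matrix (Suc n) l a b v =
    (if odd n then
       Conj (Conj (Less a (Var v)) (Neg (Less b (Var v))))
         (Conj (bound_matrix n (l - l div 2) a (Var v) (Suc v))
               (bound_matrix n (l div 2) (Var v) b (Suc v)))
     else if l = 0 then Eq a b
     else
       Disj (Neg (Conj (Less a (Var v)) (Less (Var v) b)))
         (Disj (bound_matrix n (l - 1 - (l - 1) div 2) a (Var v) (Suc v))
               (bound_matrix n ((l - 1) div 2) (Var v) b (Suc v))))"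

lemma num_quants_bound_matrix: "num_quants (bound_matrix n l a b v) = 0"
  by (induction n arbitrary: l a b v) auto

lemma free_vars_bound_matrix:
  "free_vars (bound_matrix n l a b v) \<subseteq> tm_vars a \<union> tm_vars b \<union> {v..<v + n}"
proof (induction n arbitrary: l a b v)
  case (Suc n)
  have "free_vars (bound_matrix n k a (Var v) (Suc v)) \<subseteq> tm_vars a \<union> tm_vars b \<union> {v..<v + Suc n}"
    "free_vars (bound_matrix n k (Var v) b (Suc v)) \<subseteq> tm_vars a \<union> tm_vars b \<union> {v..<v + Suc n}" for k
    using Suc[of k a "Var v" "Suc v"] Suc[of k "Var v" b "Suc v"] by auto
  then show ?case by simp
qed auto

section \<open>Truth in finite linear orders\<close>

lemma tm_val_cong: "(\<And>i. i \<in> tm_vars t \<Longrightarrow> e' i = e i) \<Longrightarrow> tm_val M e' t = tm_val M e t"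
  by (cases t) auto

lemma lin_ord_simps [simp]:
  "universe (lin_ord m) = {0..m}" "less_in (lin_ord m) = (<)"
  "min_in (lin_ord m) = 0" "max_in (lin_ord m) = m"
  by (simp_all add: lin_ord_def)

text \<open>Take the point at distance \<open>i - i div 2\<close> above \<open>A\<close>, capped at
  \<open>X\<close>. The hypotheses force \<open>i > 0\<close>, so this distance is positive and the
  point lies strictly above \<open>A\<close>.\<close>

lemma ex_near_midpoint:
  fixes A X i :: nat
  assumes "A < X" "X - A \<le> i"
  shows "\<exists>y. A < y \<and> y \<le> X \<and> y - A \<le> i - i div 2 \<and> X - y \<le> i div 2"
proof (cases "X - A \<le> i - i div 2")
  case True
  then show ?thesis using assms by (intro exI[of _ X]) auto
next
  case False
  have "A < A + (i - i div 2)" "A + (i - i div 2) - A \<le> i - i div 2"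
    using assms by simp_all
  moreover have "A + (i - i div 2) \<le> X" "X - (A + (i - i div 2)) \<le> i div 2"
    using assms False by linarith+
  ultimately show ?thesis by blast
qed

text \<open>The induction has to run over pairs of adjacent intervals sharing one quantifier prefix.\<close>

lemma sat_bound_matrix_pair:
  fixes a x b :: tm and e :: "nat \<Rightarrow> nat" and m :: nat
  defines "A \<equiv> tm_val (lin_ord m) e a" and "X \<equiv> tm_val (lin_ord m) e x"
    and "B \<equiv> tm_val (lin_ord m) e b"
  assumes "tm_vars a \<subseteq> {..<v}" "tm_vars x \<subseteq> {..<v}" "tm_vars b \<subseteq> {..<v}"
    and "i \<le> reach n" "j \<le> reach n" "A \<le> X" "X \<le> B" "B \<le> m"
  shows "even n \<Longrightarrow> A < X \<Longrightarrow>
      sat (lin_ord m) e (alt_prefix n v (Disj (bound_matrix n i a x v) (bound_matrix n j x b v)))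
      \<longleftrightarrow> X - A \<le> i \<or> X < B \<and> B - X \<le> j"
    and "odd n \<Longrightarrow>
      sat (lin_ord m) e (alt_prefix n v (Conj (bound_matrix n i a x v) (bound_matrix n j x b v)))
      \<longleftrightarrow> X - A \<le> i \<and> B - X \<le> j"
  using assms(4-) unfolding A_def X_def B_def
proof (induction n arbitrary: v e a x b i j)
  \<comment> \<open>\<open>reach 0 = 0\<close> forces \<open>i = j = 0\<close>, so both sides of the
    even claim are false.\<close>
  case 0
  { case 1 then show ?case by auto }
  { case 2 then show ?case by auto }
next
  case (Suc n)
  { case 1
    define A where "A = tm_val (lin_ord m) e a"
    define X where "X = tm_val (lin_ord m) e x"
    define B where "B = tm_val (lin_ord m) e b"
    let ?\<phi> = "Disj (bound_matrix (Suc n) i a x v) (bound_matrix (Suc n) j x b v)"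
    have n: "odd n" using 1 by simp
    have ord: "A < X" "X \<le> B" "B \<le> m"
      using 1 by (auto simp: A_def X_def B_def)
    have reach: "i - i div 2 \<le> reach n" "i div 2 \<le> reach n"
        "j - j div 2 \<le> reach n" "j div 2 \<le> reach n"
      using 1 n by auto
    have vars: "tm_vars a \<subseteq> {..<Suc v}" "tm_vars x \<subseteq> {..<Suc v}" "tm_vars b \<subseteq> {..<Suc v}"
        "v \<notin> tm_vars a" "v \<notin> tm_vars x" "v \<notin> tm_vars b"
      using 1 by auto
    \<comment> \<open>The half-open intervals are disjoint, so the guard at \<open>y\<close>
      falsifies at least one disjunct. The surviving one is a conjunction of two adjacent bounds, to
      which the odd claim applies.\<close>
    have step: "sat (lin_ord m) (e(v := y)) (alt_prefix n (Suc v) ?\<phi>) \<longleftrightarrow>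
        A < y \<and> y \<le> X \<and> y - A \<le> i - i div 2 \<and> X - y \<le> i div 2 \<or>
        X < y \<and> y \<le> B \<and> y - X \<le> j - j div 2 \<and> B - y \<le> j div 2" (is "?l \<longleftrightarrow> _") for y
    proof -
      have val: "tm_val (lin_ord m) (e(v := y)) a = A" "tm_val (lin_ord m) (e(v := y)) x = X"
          "tm_val (lin_ord m) (e(v := y)) b = B"
        using vars by (auto simp: A_def X_def B_def intro!: tm_val_cong)
      have val': "tm_val (lin_ord m) e' a = A" "tm_val (lin_ord m) e' x = X"
          "tm_val (lin_ord m) e' b = B" "e' v = y"
        if "\<And>k. k < Suc v \<Longrightarrow> e' k = (e(v := y)) k" for e'
        using that vars val tm_val_cong[of _ e' "e(v := y)" "lin_ord m"] by (metis fun_upd_same lessI lessThan_iff subsetD)+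
      consider "A < y" "y \<le> X" | "X < y" "y \<le> B" | "y \<le> A \<or> B < y" by linarith
      then show ?thesis
      proof cases
        case 1
        have "?l \<longleftrightarrow> sat (lin_ord m) (e(v := y)) (alt_prefix n (Suc v)
            (Conj (bound_matrix n (i - i div 2) a (Var v) (Suc v))
                  (bound_matrix n (i div 2) (Var v) x (Suc v))))"
          by (rule sat_alt_prefix_cong) (use 1 n val' in auto)
        also have "\<dots> \<longleftrightarrow> y - A \<le> i - i div 2 \<and> X - y \<le> i div 2"
          using Suc.IH(2)[of a "Suc v" "Var v" x "i - i div 2" "i div 2" "e(v := y)"]
            1 n ord reach vars val by (simp del: fun_upd_apply add: fun_upd_same)
        finally show ?thesis using 1 by auto
      next
        case 2
        have "?l \<longleftrightarrow> sat (lin_ord m) (e(v := y)) (alt_prefix n (Suc v)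
            (Conj (bound_matrix n (j - j div 2) x (Var v) (Suc v))
                  (bound_matrix n (j div 2) (Var v) b (Suc v))))"
          by (rule sat_alt_prefix_cong) (use 2 n ord val' in auto)
        also have "\<dots> \<longleftrightarrow> y - X \<le> j - j div 2 \<and> B - y \<le> j div 2"
          using Suc.IH(2)[of x "Suc v" "Var v" b "j - j div 2" "j div 2" "e(v := y)"]
            2 n ord reach vars val by (simp del: fun_upd_apply add: fun_upd_same)
        finally show ?thesis using 2 by auto
      next
        case 3
        have "?l \<longleftrightarrow> False"
          by (rule sat_alt_prefix_const) (use 3 n ord val' in auto)
        then show ?thesis using 3 ord by auto
      qed
    qed
    have "sat (lin_ord m) e (alt_prefix (Suc n) v ?\<phi>) \<longleftrightarrow>
        (\<exists>y\<in>{0..m}. sat (lin_ord m) (e(v := y)) (alt_prefix n (Suc v) ?\<phi>))"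
      using n by simp
    also have "\<dots> \<longleftrightarrow> X - A \<le> i \<or> X < B \<and> B - X \<le> j"
      unfolding step
    proof (intro iffI; (elim bexE)?)
      assume "X - A \<le> i \<or> X < B \<and> B - X \<le> j"
      then show "\<exists>y\<in>{0..m}. A < y \<and> y \<le> X \<and> y - A \<le> i - i div 2 \<and> X - y \<le> i div 2 \<or>
          X < y \<and> y \<le> B \<and> y - X \<le> j - j div 2 \<and> B - y \<le> j div 2"
      proof
        assume "X - A \<le> i"
        then show ?thesis
          using ord ex_near_midpoint[of A X i] by fastforce
      next
        assume "X < B \<and> B - X \<le> j"
        then show ?thesis
          using ord ex_near_midpoint[of X B j] by fastforce
      qed
    qed (use ord in auto)
    finally show ?case unfolding A_def X_def B_def . }
  { case 2
    define A where "A = tm_val (lin_ord m) e a"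
    define X where "X = tm_val (lin_ord m) e x"
    define B where "B = tm_val (lin_ord m) e b"
    let ?\<phi> = "Conj (bound_matrix (Suc n) i a x v) (bound_matrix (Suc n) j x b v)"
    \<comment> \<open>These satisfy \<open>i1 + i2 + 1 = i\<close> for \<open>i > 0\<close>, and
      likewise for \<open>j\<close>. A zero bound is treated separately, by the equation in the
      matrix.\<close>
    define i1 i2 j1 j2 where ij: "i1 = i - 1 - (i - 1) div 2" "i2 = (i - 1) div 2"
        "j1 = j - 1 - (j - 1) div 2" "j2 = (j - 1) div 2"
    have n: "even n" using 2 by simp
    have ord: "A \<le> X" "X \<le> B" "B \<le> m"
      using 2 by (auto simp: A_def X_def B_def)
    have reach: "i1 \<le> reach n" "i2 \<le> reach n" "j1 \<le> reach n" "j2 \<le> reach n"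
      using 2 n by (auto simp: ij)
    have vars: "tm_vars a \<subseteq> {..<Suc v}" "tm_vars x \<subseteq> {..<Suc v}" "tm_vars b \<subseteq> {..<Suc v}"
        "v \<notin> tm_vars a" "v \<notin> tm_vars x" "v \<notin> tm_vars b"
      using 2 by auto
    \<comment> \<open>A point lies strictly inside at most one of the two intervals. The negated
      guard makes the conjunct of the other true unless its bound is 0, leaving a single disjunction
      for the even claim.\<close>
    have step: "sat (lin_ord m) (e(v := y)) (alt_prefix n (Suc v) ?\<phi>) \<longleftrightarrow>
        (i = 0 \<longrightarrow> A = X) \<and> (j = 0 \<longrightarrow> X = B) \<and>
        (i \<noteq> 0 \<and> A < y \<and> y < X \<longrightarrow> y - A \<le> i1 \<or> X - y \<le> i2) \<and>
        (j \<noteq> 0 \<and> X < y \<and> y < B \<longrightarrow> y - X \<le> j1 \<or> B - y \<le> j2)" (is "?l \<longleftrightarrow> _") for y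
    proof -
      have val: "tm_val (lin_ord m) (e(v := y)) a = A" "tm_val (lin_ord m) (e(v := y)) x = X"
          "tm_val (lin_ord m) (e(v := y)) b = B"
        using vars by (auto simp: A_def X_def B_def intro!: tm_val_cong)
      have val': "tm_val (lin_ord m) e' a = A" "tm_val (lin_ord m) e' x = X"
          "tm_val (lin_ord m) e' b = B" "e' v = y"
        if "\<And>k. k < Suc v \<Longrightarrow> e' k = (e(v := y)) k" for e'
        using that vars val tm_val_cong[of _ e' "e(v := y)" "lin_ord m"] by (metis fun_upd_same lessI lessThan_iff subsetD)+
      consider "i = 0" "A \<noteq> X" | "j = 0" "X \<noteq> B"
        | "i \<noteq> 0" "A < y" "y < X" "j = 0 \<longrightarrow> X = B"
        | "j \<noteq> 0" "X < y" "y < B" "i = 0 \<longrightarrow> A = X"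
        | "i = 0 \<longrightarrow> A = X" "j = 0 \<longrightarrow> X = B"
          "\<not> (i \<noteq> 0 \<and> A < y \<and> y < X)" "\<not> (j \<noteq> 0 \<and> X < y \<and> y < B)"
        by blast
      then show ?thesis
      proof cases
        case 1
        have "?l \<longleftrightarrow> False"
          by (rule sat_alt_prefix_const) (use 1 n val' in auto)
        then show ?thesis using 1 by auto
      next
        case 2
        have "?l \<longleftrightarrow> False"
          by (rule sat_alt_prefix_const) (use 2 n val' in auto)
        then show ?thesis using 2 by auto
      next
        case 3
        have "?l \<longleftrightarrow> sat (lin_ord m) (e(v := y)) (alt_prefix n (Suc v)
            (Disj (bound_matrix n i1 a (Var v) (Suc v)) (bound_matrix n i2 (Var v) x (Suc v))))"
          by (rule sat_alt_prefix_cong) (use 3 n val' in \<open>auto simp: ij\<close>)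
        \<comment> \<open>\<open>A < y\<close> and \<open>y < X\<close> supply the nondegeneracy
          that the even claim demands of both halves.\<close>
        also have "\<dots> \<longleftrightarrow> y - A \<le> i1 \<or> X - y \<le> i2"
          using Suc.IH(1)[where a = a and v = "Suc v" and x = "Var v" and b = x
              and i = i1 and j = i2 and e = "e(v := y)"]
            3 n ord reach vars val by (simp del: fun_upd_apply add: fun_upd_same)
        finally show ?thesis using 3 by auto
      next
        case 4
        have "?l \<longleftrightarrow> sat (lin_ord m) (e(v := y)) (alt_prefix n (Suc v)
            (Disj (bound_matrix n j1 x (Var v) (Suc v)) (bound_matrix n j2 (Var v) b (Suc v))))"
          by (rule sat_alt_prefix_cong) (use 4 n val' in \<open>auto simp: ij\<close>)
        also have "\<dots> \<longleftrightarrow> y - X \<le> j1 \<or> B - y \<le> j2"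
          using Suc.IH(1)[where a = x and v = "Suc v" and x = "Var v" and b = b
              and i = j1 and j = j2 and e = "e(v := y)"]
            4 n ord reach vars val by (simp del: fun_upd_apply add: fun_upd_same)
        finally show ?thesis using 4 by auto
      next
        case 5
        have "?l \<longleftrightarrow> True"
          by (rule sat_alt_prefix_const) (use 5 n val' in auto)
        then show ?thesis using 5 by blast
      qed
    qed
    have "sat (lin_ord m) e (alt_prefix (Suc n) v ?\<phi>) \<longleftrightarrow>
        (\<forall>y\<in>{0..m}. sat (lin_ord m) (e(v := y)) (alt_prefix n (Suc v) ?\<phi>))"
      using n by simp
    also have "\<dots> \<longleftrightarrow> X - A \<le> i \<and> B - X \<le> j"
      unfolding step
    proof
      assume *: "\<forall>y\<in>{0..m}. (i = 0 \<longrightarrow> A = X) \<and> (j = 0 \<longrightarrow> X = B) \<and>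
        (i \<noteq> 0 \<and> A < y \<and> y < X \<longrightarrow> y - A \<le> i1 \<or> X - y \<le> i2) \<and>
        (j \<noteq> 0 \<and> X < y \<and> y < B \<longrightarrow> y - X \<le> j1 \<or> B - y \<le> j2)"
      show "X - A \<le> i \<and> B - X \<le> j"
      proof (rule ccontr)
        assume "\<not> (X - A \<le> i \<and> B - X \<le> j)"
        then consider "X - A > i" | "B - X > j" by linarith
        then show False
        proof cases
          case 1
          then have "i \<noteq> 0"
            using bspec[OF *, of 0] by auto
          then have "i = i1 + i2 + 1"
            by (simp add: ij)
          \<comment> \<open>The first point too far from \<open>A\<close> refutes the universal
            step: an interval longer than \<open>i1 + i2 + 1\<close> leaves it too far from
            \<open>X\<close> as well.\<close>
          moreover from this have "A + i1 + 1 < X" "\<not> X - (A + i1 + 1) \<le> i2"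
            using 1 by linarith+
          ultimately show False
            using bspec[OF *, of "A + i1 + 1"] ord by simp
        next
          case 2
          then have "j \<noteq> 0"
            using bspec[OF *, of 0] by auto
          then have "j = j1 + j2 + 1"
            by (simp add: ij)
          moreover from this have "X + j1 + 1 < B" "\<not> B - (X + j1 + 1) \<le> j2"
            using 2 by linarith+
          ultimately show False
            using bspec[OF *, of "X + j1 + 1"] ord by simp
        qed
      qed
    qed (use ord in \<open>auto simp: ij\<close>)
    finally show ?case unfolding A_def X_def B_def . }
qed

section \<open>The separating sentence\<close>

text \<open>The second component of each pair bounds the degenerate interval from the maximum to itself.\<close>

definition length_le_sentence :: "nat \<Rightarrow> nat \<Rightarrow> fm" where
  "length_le_sentence n l = alt_prefix n 0
    ((if even n then Disj else Conj)
      (bound_matrix n l Min_const Max_const 0) (bound_matrix n 0 Max_const Max_const 0))"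

text \<open>The degenerate second interval contributes a false disjunct for even \<open>n\<close>
  and a true conjunct for odd \<open>n\<close>. For even \<open>n\<close>, \<open>1 \<le> m\<close>
  makes the first interval nondegenerate.\<close>

lemma sat_length_le_sentence:
  assumes "l \<le> reach n" "1 \<le> m"
  shows "sat (lin_ord m) e (length_le_sentence n l) \<longleftrightarrow> m \<le> l"
  using sat_bound_matrix_pair[of Min_const 0 Max_const Max_const l n 0 m e] assms
  by (auto simp: length_le_sentence_def)

lemma separates_length_le_sentence:
  assumes "l \<le> reach n"
  shows "separates (length_le_sentence n l) (lin_ords_le l) (lin_ords_gt l)"
proof -
  have "true_in (lin_ord m) (length_le_sentence n l) \<longleftrightarrow> m \<le> l" if "1 \<le> m" for m
    using sat_length_le_sentence[OF assms that]
    by (auto simp: true_in_def intro!: exI[of _ "\<lambda>_. 0"])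
  then show ?thesis
    by (auto simp: separates_def lin_ords_le_def lin_ords_gt_def)
qed

theorem theorem4p6:
  fixes l :: nat
  assumes "l \<ge> 1"
  shows "\<exists>\<sigma>. sentence \<sigma> \<and> prenex \<sigma>
    \<and> separates \<sigma> (lin_ords_le l) (lin_ords_gt l)
    \<and> num_quants \<sigma> = q_star l
    \<and> real (num_quants \<sigma>) \<le> log 2 (real l) + 2
    \<and> distinct_adj (quant_prefix \<sigma>)
    \<and> quant_prefix \<sigma> \<noteq> [] \<and> last (quant_prefix \<sigma>) = QForall"
proof -
  have le: "l \<le> reach (q_star l)"
    using q_star_le_iff[OF assms] by blast
  then obtain n where n: "q_star l = Suc n"
    using assms by (cases "q_star l") auto
  let ?\<sigma> = "length_le_sentence (Suc n) l"
  have "sentence ?\<sigma>"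
    using free_vars_bound_matrix[of "Suc n" l Min_const Max_const 0]
      free_vars_bound_matrix[of "Suc n" 0 Max_const Max_const 0]
    by (auto simp: sentence_def length_le_sentence_def free_vars_alt_prefix
        simp del: alt_prefix.simps bound_matrix.simps)
  moreover have num: "num_quants ?\<sigma> = Suc n"
    by (simp add: length_le_sentence_def num_quants_alt_prefix num_quants_bound_matrix
        del: alt_prefix.simps bound_matrix.simps)
  moreover have "real (Suc n) \<le> log 2 (real l) + 2"
  proof (cases n)
    case 0
    then show ?thesis using assms zero_le_log_cancel_iff[of 2 "real l"] by simp
  next
    case (Suc k)
    \<comment> \<open>By minimality of \<open>q_star l\<close>, one quantifier fewer does not
      suffice; this gives the logarithmic bound.\<close>
    have "reach (Suc k) < l"
      using q_star_le_iff[OF assms, of n] n Suc by (simp del: reach.simps)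
    then have "2 ^ k \<le> l"
      using two_power_le_reach[of k] by linarith
    then have "real k \<le> log 2 (real l)"
      using le_log2_of_power by blast
    then show ?thesis using Suc by simp
  qed
  moreover have "prenex ?\<sigma>"
    unfolding length_le_sentence_def
    by (rule prenex_alt_prefix) (simp add: num_quants_bound_matrix del: bound_matrix.simps)
  moreover have "distinct_adj (quant_prefix ?\<sigma>) \<and> quant_prefix ?\<sigma> \<noteq> []
      \<and> last (quant_prefix ?\<sigma>) = QForall"
    unfolding length_le_sentence_def
    using quant_prefix_alt_prefix
    by (simp add: num_quants_bound_matrix del: alt_prefix.simps bound_matrix.simps)
  ultimately show ?thesis
    using separates_length_le_sentence[of l "Suc n"] le n by auto
qed

end
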